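(* Let $\mathbf{y}=(y_1,y_2)\in\mathbb{N}^2$. (1) If $y_1<y_2$, then $\mathsf{PA}^{\mathrm{inv}}_2(\mathbf{y})=\{(1,1)\}$. (2) If $y_1\ge y_2$, then $\mathsf{PA}^{\mathrm{inv}}_2(\mathbf{y})=\{(1,1),(1,y_2+1),(y_2+1,1)\}$.
   Context: $\mathbb{N}=\{1,2,3,\ldots\}$ and $[k]=\{1,\ldots,k\}$. Let $\mathbf{y}=(y_1,\ldots,y_n)\in\mathbb{N}^n$ be car lengths and $m=\sum_{i=1}^n y_i$. A one-way street has spots $1,\ldots,m$, initially empty. Given preferences $\mathbf{x}=(x_1,\ldots,x_n)\in[m]^n$, cars $1,\ldots,n$ enter in this order; car $i$ parks in spots $j,j+1,\ldots,j+y_i-1$, where $j\ge x_i$ is the smallest integer such that $j+y_i-1\le m$ and all these spots are unoccupied; if no such $j$ exists, parking fails. If all cars park, $\mathbf{x}$ is a parking assortment for $\mathbf{y}$; $\mathsf{PA}_n(\mathbf{y})$ is the set of these. $\mathsf{PA}^{\mathrm{inv}}_n(\mathbf{y})$ is the set of (permutation) invariant parking assortments: those $\mathbf{x}\in\mathsf{PA}_n(\mathbf{y})$ all of whose rearrangements are also in $\mathsf{PA}_n(\mathbf{y})$ (with $\mathbf{y}$ fixed). *)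

theory Defs
  imports Main "HOL-Library.Multiset"
begin

text \<open>
  Tuples of car lengths and of preferences are lists (position 0 is car 1), so the number
  \<open>n\<close> of cars is the length of the list of car lengths. Car lengths are meant to be positive, so the
  truncated subtraction in \<open>j + len - 1\<close> is the true one. Spots are the naturals \<open>1, \<dots>, m\<close>.
\<close>

definition can_park :: "nat \<Rightarrow> nat set \<Rightarrow> nat \<Rightarrow> nat \<Rightarrow> nat \<Rightarrow> bool" where
  "can_park m occ len pref j \<longleftrightarrow>
     pref \<le> j \<and> j + len - 1 \<le> m \<and> {j..j + len - 1} \<inter> occ = {}"

text \<open>
  \<open>all_park m occ y x\<close>: the remaining cars, with lengths \<open>y\<close> and preferences \<open>x\<close>, all park when
  entering in order a street with spots \<open>1, \<dots>, m\<close>, of which those in \<open>occ\<close> are already occupied.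
\<close>

fun all_park :: "nat \<Rightarrow> nat set \<Rightarrow> nat list \<Rightarrow> nat list \<Rightarrow> bool" where
  "all_park m occ [] [] \<longleftrightarrow> True"
| "all_park m occ (len # y) (pref # x) \<longleftrightarrow>
     (\<exists>j. can_park m occ len pref j) \<and>
     (let j = (LEAST j. can_park m occ len pref j)
      in all_park m (occ \<union> {j..j + len - 1}) y x)"
| "all_park m occ _ _ \<longleftrightarrow> False"

definition PA :: "nat list \<Rightarrow> nat list set" where
  "PA y = {x. length x = length y \<and> set x \<subseteq> {1..sum_list y} \<and>
              all_park (sum_list y) {} y x}"

definition PA_inv :: "nat list \<Rightarrow> nat list set" where
  "PA_inv y = {x \<in> PA y. \<forall>x'. mset x' = mset x \<longrightarrow> x' \<in> PA y}"

end

theory Submission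
  imports Defs
begin

text \<open>
  The first car parks exactly at its preference, leaving \<open>y2\<close> free spots in total. The second car
  needs all of them to be contiguous, so the first car must stand at one end of the street: at
  spot \<open>1\<close> or at spot \<open>y2 + 1\<close>. Invariance then amounts to checking both orders of a pair.
\<close>

lemma ex_can_park_empty:
  "(\<exists>j. can_park m {} len pref j) \<longleftrightarrow> pref + len - 1 \<le> m"
  unfolding can_park_def by (auto intro: exI[of _ pref])

lemma Least_can_park_empty:
  assumes "pref + len - 1 \<le> m"
  shows "(LEAST j. can_park m {} len pref j) = pref"
  using assms by (intro Least_equality) (auto simp: can_park_def)

text \<open>Positive lengths make both intervals nonempty, so they are disjoint iff one ends before
  the other starts. This leaves linear inequalities without truncated subtraction.\<close>

lemma can_park_interval:
  assumes "len \<ge> 1" and "len' \<ge> 1"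
  shows "can_park m {a..a + len' - 1} len pref j \<longleftrightarrow>
    pref \<le> j \<and> j + len \<le> m + 1 \<and> (j + len \<le> a \<or> a + len' \<le> j)"
proof -
  have "{j..j + len - 1} \<inter> {a..a + len' - 1} = {} \<longleftrightarrow> j + len \<le> a \<or> a + len' \<le> j"
    using assms by (auto simp: Int_atLeastAtMost)
  then show ?thesis
    using assms unfolding can_park_def by auto
qed

text \<open>The asymmetry in \<open>b\<close>: a gap at the right end starts at
  \<open>y1 + 1\<close> and is reached from any earlier preference, while a gap at the left end is
  reached only from spot \<open>1\<close>.\<close>

lemma PA_pair_iff:
  assumes "y1 \<ge> 1" and "y2 \<ge> 1"
  shows "[a, b] \<in> PA [y1, y2] \<longleftrightarrow>
    a = 1 \<and> 1 \<le> b \<and> b \<le> y1 + 1 \<or> a = y2 + 1 \<and> b = 1"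
proof -
  let ?m = "y1 + y2"
  have "[a, b] \<in> PA [y1, y2] \<longleftrightarrow> a \<in> {1..?m} \<and> b \<in> {1..?m} \<and> a + y1 - 1 \<le> ?m \<and>
      (\<exists>j. can_park ?m {a..a + y1 - 1} y2 b j)"
    \<comment> \<open>On the empty street the \<open>LEAST\<close> is \<open>a\<close> itself; for
      the last car only existence of a spot matters.\<close>
    by (auto simp: PA_def ex_can_park_empty Least_can_park_empty)
  also have "\<dots> \<longleftrightarrow> a \<in> {1..?m} \<and> b \<in> {1..?m} \<and> a + y1 - 1 \<le> ?m \<and>
      (\<exists>j. b \<le> j \<and> j + y2 \<le> ?m + 1 \<and> (j + y2 \<le> a \<or> a + y1 \<le> j))"
    by (intro conj_cong refl ex_cong1 can_park_interval assms)
  also have "\<dots> \<longleftrightarrow> a = 1 \<and> 1 \<le> b \<and> b \<le> y1 + 1 \<or> a = y2 + 1 \<and> b = 1"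
    (is "?fits \<longleftrightarrow> ?ends")
  proof
    assume ?ends
    then show ?fits
    proof
      assume "a = 1 \<and> 1 \<le> b \<and> b \<le> y1 + 1"
      then show ?fits
        using assms by (auto intro: exI[of _ "y1 + 1"])
    next
      assume "a = y2 + 1 \<and> b = 1"
      then show ?fits
        using assms by (auto intro: exI[of _ 1])
    qed
  \<comment> \<open>Conversely, \<open>j + y2 \<le> a \<le> y2 + 1\<close> forces
    \<open>j = 1\<close>, hence \<open>b = 1\<close>, and \<open>a + y1 \<le> j \<le> y1 + 1\<close>
    forces \<open>a = 1\<close>.\<close>
  qed (use assms in auto)
  finally show ?thesis .
qed

lemma mset_eq_pair_iff: "mset xs = mset [a, b] \<longleftrightarrow> xs = [a, b] \<or> xs = [b, a]"
proof
  assume eq: "mset xs = mset [a, b]"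
  then have "length xs = 2"
    using mset_eq_length by fastforce
  then obtain c d where "xs = [c, d]"
    by (auto simp: numeral_2_eq_2 length_Suc_conv)
  then show "xs = [a, b] \<or> xs = [b, a]"
    using eq by (auto simp: add_eq_conv_ex)
qed auto

lemma PA_inv_pair_iff:
  "[a, b] \<in> PA_inv [y1, y2] \<longleftrightarrow> [a, b] \<in> PA [y1, y2] \<and> [b, a] \<in> PA [y1, y2]"
  unfolding PA_inv_def mem_Collect_eq mset_eq_pair_iff by blast

lemma PA_inv_pair_cases:
  assumes "x \<in> PA_inv [y1, y2]"
  obtains a b where "x = [a, b]"
  using assms by (auto simp: PA_inv_def PA_def length_Suc_conv)

theorem theorem5p1:
  fixes y1 y2 :: nat
  assumes "y1 \<ge> 1" and "y2 \<ge> 1"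
  shows "(y1 < y2 \<longrightarrow> PA_inv [y1, y2] = {[1, 1]}) \<and>
         (y1 \<ge> y2 \<longrightarrow> PA_inv [y1, y2] = {[1, 1], [1, y2 + 1], [y2 + 1, 1]})"
proof -
  \<comment> \<open>The guard \<open>y2 \<le> y1\<close> is the bound \<open>b \<le> y1 + 1\<close>
    of the order starting with \<open>1\<close>, taken at \<open>b = y2 + 1\<close>.\<close>
  have iff: "[a, b] \<in> PA_inv [y1, y2] \<longleftrightarrow>
      a = 1 \<and> b = 1 \<or> y2 \<le> y1 \<and> (a = 1 \<and> b = y2 + 1 \<or> a = y2 + 1 \<and> b = 1)" for a b
    unfolding PA_inv_pair_iff PA_pair_iff[OF assms] using assms by auto
  have "x \<in> PA_inv [y1, y2] \<longleftrightarrow> x = [1, 1] \<or> y2 \<le> y1 \<and> (x = [1, y2 + 1] \<or> x = [y2 + 1, 1])"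
    for x
  proof
    assume x: "x \<in> PA_inv [y1, y2]"
    then obtain a b where "x = [a, b]"
      by (rule PA_inv_pair_cases)
    with x show "x = [1, 1] \<or> y2 \<le> y1 \<and> (x = [1, y2 + 1] \<or> x = [y2 + 1, 1])"
      by (simp add: iff)
  qed (auto simp: iff)
  then show ?thesis
    by (auto simp: set_eq_iff)
qed

end
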